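(* Let $k\ge1$, let $S_1,\dots,S_{k+1}$ be sets and $(\alpha_1,\dots,\alpha_{k+1})\in{}^{\ast}(S_1\times\dots\times S_{k+1})$. The following are equivalent: (1) $(\alpha_1,\dots,\alpha_{k+1})$ is a tensor $(k+1)$-ple; (2) for every $F=\{i_1<\dots<i_l\}\subseteq\{1,\dots,k+1\}$, $(\alpha_{i_1},\dots,\alpha_{i_l})$ is a tensor $l$-ple.
   Context: Work in a single superstructure model of nonstandard methods with star map $\ast$ satisfying transfer. For $\gamma\in{}^{\ast}Y$, $\mathfrak{U}_\gamma=\{A\subseteq Y\mid\gamma\in{}^{\ast}A\}$. For $\mathcal{U}_i\in\beta S_i$, $\mathcal{U}_1\otimes\dots\otimes\mathcal{U}_k$ is the ultrafilter on $S_1\times\dots\times S_k$ with $A\in\mathcal{U}_1\otimes\dots\otimes\mathcal{U}_k$ iff $\{s_1\in S_1\mid\{s_2\in S_2\mid\dots\{s_k\in S_k\mid(s_1,\dots,s_k)\in A\}\in\mathcal{U}_k\}\dots\}\in\mathcal{U}_1$. A tuple $(\alpha_1,\dots,\alpha_k)\in{}^{\ast}(S_1\times\dots\times S_k)$ is a tensor $k$-ple if $\mathfrak{U}_{(\alpha_1,\dots,\alpha_k)}=\mathfrak{U}_{\alpha_1}\otimes\dots\otimes\mathfrak{U}_{\alpha_k}$. *)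

theory Defs
  imports Main
begin

text \<open>Formulas of the language of set theory in which every quantifier is bounded;
  \<open>BAll i j \<phi>\<close> stands for \<open>\<forall>x\<^sub>i \<in> x\<^sub>j. \<phi>\<close>.\<close>

datatype bfm =
    Mem nat nat
  | Eq nat nat
  | Neg bfm
  | Conj bfm bfm
  | BAll nat nat bfm

primrec sat :: "('v \<Rightarrow> 'v \<Rightarrow> bool) \<Rightarrow> (nat \<Rightarrow> 'v) \<Rightarrow> bfm \<Rightarrow> bool" where
  "sat E e (Mem i j) \<longleftrightarrow> E (e i) (e j)"
| "sat E e (Eq i j) \<longleftrightarrow> e i = e j"
| "sat E e (Neg \<phi>) \<longleftrightarrow> \<not> sat E e \<phi>"
| "sat E e (Conj \<phi> \<psi>) \<longleftrightarrow> sat E e \<phi> \<and> sat E e \<psi>"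
| "sat E e (BAll i j \<phi>) \<longleftrightarrow> (\<forall>y. E y (e j) \<longrightarrow> sat E (e(i := y)) \<phi>)"

text \<open>For \<open>X\<close> a set of atoms in a type with membership relation \<open>E\<close>:
  \<open>V\<^sub>0(X) = X\<close> and \<open>V\<^sub>n\<^sub>+\<^sub>1(X) = V\<^sub>n(X) \<union> \<P>(V\<^sub>n(X))\<close>.\<close>

primrec level :: "'v set \<Rightarrow> ('v \<Rightarrow> 'v \<Rightarrow> bool) \<Rightarrow> nat \<Rightarrow> 'v set" where
  "level X E 0 = X"
| "level X E (Suc n) = level X E n \<union> {v. v \<notin> X \<and> {x. E x v} \<subseteq> level X E n}"

text \<open>The type \<open>'v\<close> with membership \<open>E\<close> is the superstructure \<open>V(X)\<close> (determined by \<open>X\<close> up to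
  isomorphism). It is axiomatized because the union of all finite levels over an
  arbitrary \<open>X\<close> cannot be constructed as a type in HOL.\<close>

locale superstructure =
  fixes X :: "'v set" and E :: "'v \<Rightarrow> 'v \<Rightarrow> bool"
  assumes atoms: "a \<in> X \<Longrightarrow> \<not> E x a"
    and extensional: "u \<notin> X \<Longrightarrow> v \<notin> X \<Longrightarrow> {x. E x u} = {x. E x v} \<Longrightarrow> u = v"
    and powerset: "A \<subseteq> level X E n \<Longrightarrow> \<exists>v. v \<notin> X \<and> {x. E x v} = A"
    and exhausted: "\<exists>n. v \<in> level X E n"
begin

text \<open>\<open>is_set A\<close>: the collection \<open>A\<close> is a set of the superstructure;
  \<open>as_elem A\<close> is then the element of \<open>V(X)\<close> that it is.\<close>

definition is_set :: "'v set \<Rightarrow> bool" where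
  "is_set A \<longleftrightarrow> (\<exists>n. A \<subseteq> level X E n)"

definition as_elem :: "'v set \<Rightarrow> 'v" where
  "as_elem A = (THE v. v \<notin> X \<and> {x. E x v} = A)"

definition pair :: "'v \<Rightarrow> 'v \<Rightarrow> 'v" where
  "pair a b = as_elem {as_elem {a}, as_elem {a, b}}"

fun tuple :: "'v list \<Rightarrow> 'v" where
  "tuple [] = as_elem {}"
| "tuple [a] = a"
| "tuple (a # b # as) = pair a (tuple (b # as))"

definition product :: "'v set list \<Rightarrow> 'v set" where
  "product Ss = tuple ` listset Ss"

text \<open>\<open>iterated [S\<^sub>1,\<dots>,S\<^sub>k] [U\<^sub>1,\<dots>,U\<^sub>k] P\<close> is
  \<open>{s\<^sub>1 \<in> S\<^sub>1. \<dots> {s\<^sub>k \<in> S\<^sub>k. P [s\<^sub>1,\<dots>,s\<^sub>k]} \<in> U\<^sub>k \<dots>} \<in> U\<^sub>1\<close>; only lists of equal length matter.\<close>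

fun iterated :: "'v set list \<Rightarrow> 'v set set list \<Rightarrow> ('v list \<Rightarrow> bool) \<Rightarrow> bool" where
  "iterated (S # Ss) (U # Us) P \<longleftrightarrow> {s \<in> S. iterated Ss Us (\<lambda>ss. P (s # ss))} \<in> U"
| "iterated _ _ P \<longleftrightarrow> P []"

definition tensor :: "'v set list \<Rightarrow> 'v set set list \<Rightarrow> 'v set set" where
  "tensor Ss Us = {A. A \<subseteq> product Ss \<and> iterated Ss Us (\<lambda>ss. tuple ss \<in> A)}"

end

locale single_superstructure_model = superstructure X E
  for X :: "'v set" and E :: "'v \<Rightarrow> 'v \<Rightarrow> bool" +
  fixes star :: "'v \<Rightarrow> 'v"
  assumes star_base: "star (as_elem X) = as_elem X"
    and transfer: "sat E e \<phi> \<longleftrightarrow> sat E (star \<circ> e) \<phi>"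
begin

definition star_set :: "'v set \<Rightarrow> 'v set" where
  "star_set A = {x. E x (star (as_elem A))}"

definition generated_ultrafilter :: "'v set \<Rightarrow> 'v \<Rightarrow> 'v set set" where
  "generated_ultrafilter Y \<gamma> = {A. A \<subseteq> Y \<and> \<gamma> \<in> star_set A}"

definition tensor_tuple :: "'v set list \<Rightarrow> 'v list \<Rightarrow> bool" where
  "tensor_tuple Ss \<alpha>s \<longleftrightarrow>
     length \<alpha>s = length Ss \<and>
     tuple \<alpha>s \<in> star_set (product Ss) \<and>
     generated_ultrafilter (product Ss) (tuple \<alpha>s) =
       tensor Ss (map2 generated_ultrafilter Ss \<alpha>s)"

end

end

theory Submission
  imports Defs
begin

text \<open>The coordinate projection \<open>\<pi>\<^sub>F\<close> of tuples of a fixed length is definable by a bounded formula,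
  so transfer gives \<open>\<alpha> \<in> \<^sup>*(\<pi>\<^sub>F\<^sup>-\<^sup>1 A)\<close> iff \<open>\<pi>\<^sub>F \<alpha> \<in> \<^sup>*A\<close>. On the other side, membership of
  \<open>\<pi>\<^sub>F\<^sup>-\<^sup>1 A\<close> in the tensor product of ultrafilters reduces to membership of \<open>A\<close> in the tensor product
  over \<open>F\<close>, because a quantifier over a proper filter is vacuous when the matrix does not depend on
  its variable.\<close>

section \<open>Selecting the entries of a list at an index set\<close>

lemma nths_zip: "length xs = length ys \<Longrightarrow> nths (zip xs ys) F = zip (nths xs F) (nths ys F)"
  by (induction xs ys arbitrary: F rule: list_induct2) (auto simp: nths_Cons)

lemma listset_length: "xs \<in> listset Ss \<Longrightarrow> length xs = length Ss"
  by (induction Ss arbitrary: xs) (auto simp: set_Cons_def)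

lemma nths_in_listset: "xs \<in> listset Ss \<Longrightarrow> nths xs F \<in> listset (nths Ss F)"
  by (induction Ss arbitrary: xs F) (auto simp: set_Cons_def nths_Cons)

lemma nths_singleton: "i < length xs \<Longrightarrow> nths xs {i} = [xs ! i]"
proof (induction xs arbitrary: i)
  case (Cons x xs)
  then show ?case by (cases i) (auto simp: nths_Cons)
qed simp

section \<open>Bounded formulas for pairs, tuples and projections\<close>

abbreviation BEx :: "nat \<Rightarrow> nat \<Rightarrow> bfm \<Rightarrow> bfm" where
  "BEx i j \<phi> \<equiv> Neg (BAll i j (Neg \<phi>))"

abbreviation Disj :: "bfm \<Rightarrow> bfm \<Rightarrow> bfm" where
  "Disj \<phi> \<psi> \<equiv> Neg (Conj (Neg \<phi>) (Neg \<psi>))"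

text \<open>In the following formulas the bound variables are numbered from \<open>m\<close> on.\<close>

definition pair_fm :: "nat \<Rightarrow> nat \<Rightarrow> nat \<Rightarrow> nat \<Rightarrow> bfm" where
  "pair_fm p a b m =
     BEx m p (BEx (m + 1) p
       (Conj (Conj (Mem a m) (BAll (m + 2) m (Eq (m + 2) a)))
       (Conj (Conj (Mem a (m + 1)) (Conj (Mem b (m + 1))
                (BAll (m + 2) (m + 1) (Disj (Eq (m + 2) a) (Eq (m + 2) b)))))
         (BAll (m + 2) p (Disj (Eq (m + 2) m) (Eq (m + 2) (m + 1)))))))"

text \<open>The tail of a pair is an element of an element of it, so quantifying over it in a
  bounded way takes two steps. The false formula for \<open>[]\<close> is a default value.\<close>

fun tuple_fm :: "nat \<Rightarrow> nat list \<Rightarrow> nat \<Rightarrow> bfm" where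
  "tuple_fm p [] m = Neg (Eq p p)"
| "tuple_fm p [a] m = Eq p a"
| "tuple_fm p (a # b # as) m =
     BEx m p (BEx (m + 1) m (Conj (pair_fm p a (m + 1) (m + 2)) (tuple_fm (m + 1) (b # as) (m + 2))))"

text \<open>\<open>proj_fm F q p n xs m\<close> says that \<open>p\<close> is an \<open>(n+1)\<close>-tuple \<open>ss\<close> and that \<open>q\<close> is the tuple of the
  entries of \<open>xs @ ss\<close> with indices in \<open>F\<close>; \<open>xs\<close> accumulates the components already split off.\<close>

fun proj_fm :: "nat set \<Rightarrow> nat \<Rightarrow> nat \<Rightarrow> nat \<Rightarrow> nat list \<Rightarrow> nat \<Rightarrow> bfm" where
  "proj_fm F q p 0 xs m = tuple_fm q (nths (xs @ [p]) F) m"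
| "proj_fm F q p (Suc n) xs m =
     BEx m p (BEx (m + 1) m (BEx (m + 2) m
       (Conj (pair_fm p (m + 1) (m + 2) (m + 3)) (proj_fm F q (m + 2) n (xs @ [m + 1]) (m + 3)))))"

section \<open>Sets, ordered pairs, tuples and products in the superstructure\<close>

context superstructure
begin

lemma level_mono: "m \<le> n \<Longrightarrow> level X E m \<subseteq> level X E n"
  by (induction n rule: dec_induct) auto

lemma as_elem:
  assumes "is_set A"
  shows "as_elem A \<notin> X" "E x (as_elem A) \<longleftrightarrow> x \<in> A"
proof -
  obtain n where "A \<subseteq> level X E n" using assms unfolding is_set_def by blast
  then obtain v where v: "v \<notin> X \<and> {x. E x v} = A" using powerset by blast
  have "as_elem A \<notin> X \<and> {x. E x (as_elem A)} = A"
    unfolding as_elem_def by (rule theI[where a = v]) (use v extensional in auto)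
  then show "as_elem A \<notin> X" "E x (as_elem A) \<longleftrightarrow> x \<in> A" by auto
qed

lemma as_elem_eqI: "v \<notin> X \<Longrightarrow> is_set A \<Longrightarrow> (\<And>x. E x v \<longleftrightarrow> x \<in> A) \<Longrightarrow> v = as_elem A"
  by (rule extensional) (auto simp: as_elem)

lemma as_elem_inject: "is_set A \<Longrightarrow> is_set B \<Longrightarrow> as_elem A = as_elem B \<longleftrightarrow> A = B"
  by (auto simp flip: as_elem(2))

lemma is_set_subset: "is_set B \<Longrightarrow> A \<subseteq> B \<Longrightarrow> is_set A"
  unfolding is_set_def by blast

lemma is_set_empty: "is_set {}"
  by (simp add: is_set_def)

lemma is_set_insert:
  assumes "is_set A"
  shows "is_set (insert a A)"
proof -
  obtain n where n: "A \<subseteq> level X E n" using assms unfolding is_set_def by blast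
  obtain m where m: "a \<in> level X E m" using exhausted by blast
  have "insert a A \<subseteq> level X E (max n m)"
    using n m level_mono[of n "max n m"] level_mono[of m "max n m"] by auto
  then show ?thesis unfolding is_set_def by blast
qed

lemma is_set_doubleton: "is_set {a, b}" "is_set {a}"
  by (simp_all add: is_set_insert is_set_empty)

lemma E_doubleton: "E x (as_elem {a, b}) \<longleftrightarrow> x = a \<or> x = b" "E x (as_elem {a}) \<longleftrightarrow> x = a"
  by (simp_all add: as_elem is_set_doubleton)

lemma E_pair: "E x (pair a b) \<longleftrightarrow> x = as_elem {a} \<or> x = as_elem {a, b}"
  by (simp add: pair_def E_doubleton)

text \<open>Having an element, \<open>v\<close> is no atom, so extensionality applies to it.\<close>

lemma doubleton_eqI:
  assumes "E a v" "E b v" "\<And>x. E x v \<Longrightarrow> x = a \<or> x = b"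
  shows "v = as_elem {a, b}"
proof (rule as_elem_eqI)
  show "v \<notin> X" using assms(1) atoms by blast
qed (use assms in \<open>auto simp: is_set_doubleton\<close>)

text \<open>The right-hand side is what \<open>pair_fm\<close> unfolds to under
  \<open>sat\<close>.\<close>

lemma eq_pair_iff:
  "p = pair a b \<longleftrightarrow> (\<exists>u. E u p \<and> (\<exists>v. E v p \<and>
      (E a u \<and> (\<forall>w. E w u \<longrightarrow> w = a)) \<and>
      (E a v \<and> E b v \<and> (\<forall>w. E w v \<longrightarrow> w = a \<or> w = b)) \<and>
      (\<forall>w. E w p \<longrightarrow> w = u \<or> w = v)))" (is "_ \<longleftrightarrow> ?R")
proof
  assume "p = pair a b"
  then show ?R
    by (intro exI[of _ "as_elem {a}"] exI[of _ "as_elem {a, b}"] conjI) (auto simp: E_pair E_doubleton)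
next
  assume ?R
  then obtain u v where uv: "E u p" "E v p" "E a u" "\<And>w. E w u \<Longrightarrow> w = a \<or> w = a"
    "E a v" "E b v" "\<And>w. E w v \<Longrightarrow> w = a \<or> w = b" "\<And>w. E w p \<Longrightarrow> w = u \<or> w = v" by blast
  have "u = as_elem {a}" using doubleton_eqI[OF uv(3) uv(3) uv(4)] by simp
  moreover have "v = as_elem {a, b}" using uv(5-7) by (rule doubleton_eqI)
  moreover have "p = as_elem {u, v}" using uv(1,2,8) by (rule doubleton_eqI)
  ultimately show "p = pair a b" by (simp add: pair_def)
qed

lemma pair_inject: "pair a b = pair c d \<longleftrightarrow> a = c \<and> b = d"
  by (auto simp: pair_def as_elem_inject is_set_doubleton doubleton_eq_iff)

lemma tuple_Cons: "xs \<noteq> [] \<Longrightarrow> tuple (x # xs) = pair x (tuple xs)"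
  by (cases xs) auto

text \<open>Equal lengths matter: an entry may itself be a pair, so
  \<open>tuple [pair a b] = tuple [a, b]\<close>.\<close>

lemma tuple_inject: "length xs = length ys \<Longrightarrow> tuple xs = tuple ys \<Longrightarrow> xs = ys"
proof (induction xs ys rule: list_induct2)
  case (Cons x xs y ys)
  then have "ys = []" if "xs = []" using that by simp
  moreover have "ys \<noteq> []" if "xs \<noteq> []" using Cons.hyps that by auto
  ultimately show ?case using Cons by (cases "xs = []") (auto simp: tuple_Cons pair_inject)
qed simp

text \<open>Levels are cumulative, so one level contains both factors; Kuratowski pairs lie two
  levels higher.\<close>

lemma is_set_pairs:
  assumes "is_set A" "is_set B"
  shows "is_set {pair a b |a b. a \<in> A \<and> b \<in> B}"
proof -
  obtain n m where nm: "A \<subseteq> level X E n" "B \<subseteq> level X E m"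
    using assms unfolding is_set_def by blast
  define k where "k = max n m"
  have k: "A \<subseteq> level X E k" "B \<subseteq> level X E k"
    using nm level_mono[of n k] level_mono[of m k] by (auto simp: k_def)
  have "pair a b \<in> level X E (Suc (Suc k))" if "a \<in> A" "b \<in> B" for a b
  proof -
    have "as_elem {a} \<in> level X E (Suc k)" "as_elem {a, b} \<in> level X E (Suc k)"
      using that k by (auto simp: E_doubleton as_elem is_set_doubleton)
    moreover have "pair a b \<notin> X" by (simp add: pair_def as_elem is_set_doubleton)
    ultimately show ?thesis by (subst level.simps) (auto simp: E_pair simp del: level.simps)
  qed
  then show ?thesis unfolding is_set_def by blast
qed

lemma product_Cons:
  assumes "Ss \<noteq> []"
  shows "product (S # Ss) = {pair a b |a b. a \<in> S \<and> b \<in> product Ss}"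
proof -
  have "product (S # Ss) = {tuple (x # xs) |x xs. x \<in> S \<and> xs \<in> listset Ss}"
    by (auto simp: product_def set_Cons_def)
  also have "\<dots> = {pair x (tuple xs) |x xs. x \<in> S \<and> xs \<in> listset Ss}"
  proof -
    have "tuple (x # xs) = pair x (tuple xs)" if "xs \<in> listset Ss" for x xs
      using assms listset_length[OF that] by (intro tuple_Cons) auto
    then show ?thesis by (intro Collect_cong) metis
  qed
  also have "\<dots> = {pair a b |a b. a \<in> S \<and> b \<in> product Ss}"
    unfolding product_def by blast
  finally show ?thesis .
qed

lemma product_singleton: "product [S] = S"
proof -
  have "listset [S] = (\<lambda>s. [s]) ` S" by (auto simp: set_Cons_def)
  then show ?thesis by (simp add: product_def image_image)
qed

lemma is_set_product: "\<forall>S \<in> set Ss. is_set S \<Longrightarrow> is_set (product Ss)"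
proof (induction Ss)
  case Nil
  then show ?case by (simp add: product_def is_set_doubleton)
next
  case (Cons S Ss)
  then show ?case
    by (cases "Ss = []") (auto simp: product_singleton product_Cons is_set_pairs)
qed

section \<open>Truth of the formulas in the superstructure\<close>

lemma sat_pair_fm:
  "p < m \<Longrightarrow> a < m \<Longrightarrow> b < m \<Longrightarrow> sat E e (pair_fm p a b m) \<longleftrightarrow> e p = pair (e a) (e b)"
  unfolding eq_pair_iff pair_fm_def by simp blast

lemma sat_tuple_fm:
  "p < m \<Longrightarrow> \<forall>a \<in> set as. a < m \<Longrightarrow> as \<noteq> [] \<Longrightarrow>
     sat E e (tuple_fm p as m) \<longleftrightarrow> e p = tuple (map e as)"
proof (induction p as m arbitrary: e rule: tuple_fm.induct)
  case (3 p a b as m)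
  \<comment> \<open>The fresh variables \<open>m\<close> and \<open>m + 1\<close> leave the values
    of all entries unchanged, as these have indices below \<open>m\<close>.\<close>
  have *: "sat E (e(m := u, m + 1 := t)) (tuple_fm (m + 1) (b # as) (m + 2)) \<longleftrightarrow>
      t = tuple (map e (b # as))" for u t
  proof -
    have "map (e(m := u, m + 1 := t)) (b # as) = map e (b # as)" using 3(3) by auto
    moreover have "\<forall>c \<in> set (b # as). c < m + 2" using 3(3) by auto
    then have "sat E d (tuple_fm (m + 1) (b # as) (m + 2)) \<longleftrightarrow> d (m + 1) = tuple (map d (b # as))" for d
      by (intro 3(1)) auto
    ultimately show ?thesis by (simp only:) simp
  qed
  have p: "sat E (e(m := u, m + 1 := t)) (pair_fm p a (m + 1) (m + 2)) \<longleftrightarrow> e p = pair (e a) t" for u t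
    using 3(2,3) by (simp add: sat_pair_fm)
  have "sat E e (tuple_fm p (a # b # as) m) \<longleftrightarrow>
      (\<exists>u. E u (e p) \<and> (\<exists>t. E t u \<and> e p = pair (e a) t \<and> t = tuple (map e (b # as))))"
    using 3(2) p * by (simp del: list.map(2))
  also have "\<dots> \<longleftrightarrow> e p = pair (e a) (tuple (map e (b # as)))"
    by (auto simp: E_pair E_doubleton simp del: list.map(2))
  finally show ?case by simp
qed simp_all

text \<open>Induction on \<open>n\<close> splits off one component at a time and appends it to
  \<open>xs\<close>. The condition on \<open>F\<close> makes the selected list nonempty, as
  \<open>sat_tuple_fm\<close> requires.\<close>

lemma sat_proj_fm:
  "p < m \<Longrightarrow> q < m \<Longrightarrow> \<forall>a \<in> set xs. a < m \<Longrightarrow> F \<inter> {..length xs + n} \<noteq> {} \<Longrightarrow>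
     sat E e (proj_fm F q p n xs m) \<longleftrightarrow>
     (\<exists>ss. length ss = Suc n \<and> e p = tuple ss \<and> e q = tuple (nths (map e xs @ ss) F))"
proof (induction n arbitrary: p xs m e)
  case 0
  have ne: "nths (xs @ [p]) F \<noteq> []"
    using 0(4) by (auto simp: set_nths nth_append simp flip: set_empty)
  have "\<forall>a \<in> set (nths (xs @ [p]) F). a < m"
    using 0(1,3) set_nths_subset[of "xs @ [p]" F] by auto
  then have "sat E e (proj_fm F q p 0 xs m) \<longleftrightarrow> e q = tuple (nths (map e xs @ [e p]) F)"
    using sat_tuple_fm[OF 0(2) _ ne] by (simp flip: nths_map)
  then show ?case by (auto simp: length_Suc_conv)
next
  case (Suc n)
  let ?e = "\<lambda>u a t. e(m := u, m + 1 := a, m + 2 := t)"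
  have *: "sat E (?e u a t) (proj_fm F q (m + 2) n (xs @ [m + 1]) (m + 3)) \<longleftrightarrow>
      (\<exists>ss. length ss = Suc n \<and> t = tuple ss \<and> e q = tuple (nths (map e xs @ a # ss) F))" for u a t
  proof -
    have "map (?e u a t) (xs @ [m + 1]) = map e xs @ [a]" using Suc.prems(3) by auto
    moreover have "?e u a t q = e q" using Suc.prems by simp
    moreover have "sat E d (proj_fm F q (m + 2) n (xs @ [m + 1]) (m + 3)) \<longleftrightarrow>
        (\<exists>ss. length ss = Suc n \<and> d (m + 2) = tuple ss \<and>
          d q = tuple (nths (map d (xs @ [m + 1]) @ ss) F))" for d
      using Suc.prems by (intro Suc.IH) auto
    ultimately show ?thesis by (simp only:) simp
  qed
  have p: "sat E (?e u a t) (pair_fm p (m + 1) (m + 2) (m + 3)) \<longleftrightarrow> e p = pair a t" for u a t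
    using Suc.prems by (simp add: sat_pair_fm)
  have "sat E e (proj_fm F q p (Suc n) xs m) \<longleftrightarrow>
      (\<exists>u. E u (e p) \<and> (\<exists>a. E a u \<and> (\<exists>t. E t u \<and> e p = pair a t \<and>
        (\<exists>ss. length ss = Suc n \<and> t = tuple ss \<and> e q = tuple (nths (map e xs @ a # ss) F)))))"
    using Suc.prems(1) p * by (simp add: conj_ac)
  also have "\<dots> \<longleftrightarrow> (\<exists>a ss. e p = pair a (tuple ss) \<and> length ss = Suc n \<and>
        e q = tuple (nths (map e xs @ a # ss) F))"
    (is "?L \<longleftrightarrow> ?R")
  proof
    assume ?R
    then obtain a ss where "e p = pair a (tuple ss)" "length ss = Suc n"
      "e q = tuple (nths (map e xs @ a # ss) F)" by blast
    \<comment> \<open>The bounds on the quantifiers cost nothing: \<open>{a, tuple ss}\<close> is an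
      element of the pair and contains both components.\<close>
    then show ?L
      by (intro exI[of _ "as_elem {a, tuple ss}"] exI[of _ a] exI[of _ "tuple ss"] conjI)
        (auto simp: E_pair E_doubleton)
  qed blast
  also have "\<dots> \<longleftrightarrow> (\<exists>a ss. length ss = Suc n \<and> e p = tuple (a # ss) \<and>
        e q = tuple (nths (map e xs @ a # ss) F))"
  proof -
    have "tuple (a # ss) = pair a (tuple ss)" if "length ss = Suc n" for a ss
      using that by (intro tuple_Cons) auto
    then show ?thesis by (intro iff_exI) auto
  qed
  also have "\<dots> \<longleftrightarrow> (\<exists>ss. length ss = Suc (Suc n) \<and> e p = tuple ss \<and>
        e q = tuple (nths (map e xs @ ss) F))"
    unfolding length_Suc_conv[of _ "Suc n"] by blast
  finally show ?case .
qed

section \<open>Iterated ultrafilter quantifiers\<close>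

lemma iterated_cong:
  "(\<And>ss. ss \<in> listset Ss \<Longrightarrow> P ss \<longleftrightarrow> Q ss) \<Longrightarrow> length Us = length Ss \<Longrightarrow>
     iterated Ss Us P \<longleftrightarrow> iterated Ss Us Q"
proof (induction Ss arbitrary: Us P Q)
  case (Cons S Ss)
  obtain U Vs where Us: "Us = U # Vs" using Cons.prems(2) by (cases Us) auto
  have "iterated Ss Vs (\<lambda>ss. P (s # ss)) \<longleftrightarrow> iterated Ss Vs (\<lambda>ss. Q (s # ss))" if "s \<in> S" for s
    using Cons.prems that Us by (intro Cons.IH) (auto simp: set_Cons_def)
  then have "{s \<in> S. iterated Ss Vs (\<lambda>ss. P (s # ss))} = {s \<in> S. iterated Ss Vs (\<lambda>ss. Q (s # ss))}"
    by blast
  then show ?case by (simp add: Us)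
qed simp

text \<open>Induction on the lists, shifting \<open>F\<close> down by one at each step. A leading
  coordinate in \<open>F\<close> is absorbed into \<open>P\<close>; any other one is quantified
  vacuously.\<close>

lemma iterated_nths:
  "list_all2 (\<lambda>S U. S \<in> U \<and> {} \<notin> U) Ss Us \<Longrightarrow>
     iterated Ss Us (\<lambda>ss. P (nths ss F)) \<longleftrightarrow> iterated (nths Ss F) (nths Us F) P"
proof (induction Ss Us arbitrary: F P rule: list_all2_induct)
  case (Cons S Ss U Us)
  have IH: "iterated Ss Us (\<lambda>ss. Q (nths ss {j. Suc j \<in> F})) \<longleftrightarrow>
      iterated (nths Ss {j. Suc j \<in> F}) (nths Us {j. Suc j \<in> F}) Q" for Q
    by (rule Cons)
  show ?case
  proof (cases "0 \<in> F")
    case True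
    then show ?thesis by (simp add: nths_Cons IH[of "\<lambda>ss. P (_ # ss)"])
  next
    case False
    \<comment> \<open>The set tested for membership in \<open>U\<close> is all of \<open>S\<close>
      or empty, according to the truth value of the rest.\<close>
    then show ?thesis
      using Cons(1) by (cases "iterated (nths Ss {j. Suc j \<in> F}) (nths Us {j. Suc j \<in> F}) P")
        (simp_all add: nths_Cons IH)
  qed
qed simp

end

section \<open>The star map on the empty set and on projections\<close>

context single_superstructure_model
begin

lemma star_set_empty: "star_set {} = {}"
  using transfer[of "\<lambda>_. as_elem {}" "BAll 1 0 (Neg (Eq 0 0))"]
  by (simp add: as_elem is_set_empty star_set_def)

text \<open>Lacking elements is not enough, since atoms lack them too. Transferring that the empty
  set is not in \<open>X\<close>, together with \<open>star_base\<close>, shows that its image is no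
  atom.\<close>

lemma star_empty: "star (as_elem {}) = as_elem {}"
proof (rule as_elem_eqI[OF _ is_set_empty])
  have "is_set X" unfolding is_set_def by (rule exI[of _ 0]) simp
  then show "star (as_elem {}) \<notin> X"
    using transfer[of "(\<lambda>_. as_elem {})(0 := as_elem X)" "Mem 1 0"]
    by (simp add: star_base as_elem is_set_empty)
qed (use star_set_empty in \<open>simp add: star_set_def\<close>)

lemma empty_in_star_set_singleton: "as_elem {} \<in> star_set {as_elem {}}"
  using transfer[of "(\<lambda>_. as_elem {})(0 := as_elem {as_elem {}})" "Mem 1 0"]
  by (simp add: star_set_def star_empty E_doubleton)

text \<open>This covers the empty index set. The empty product has the empty set as its only
  element, so only two subsets \<open>A\<close> need checking.\<close>

lemma tensor_tuple_Nil: "tensor_tuple [] []"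
proof -
  have "A \<subseteq> {as_elem {}} \<Longrightarrow> as_elem {} \<in> star_set A \<longleftrightarrow> as_elem {} \<in> A" for A
    by (auto simp: subset_singleton_iff star_set_empty empty_in_star_set_singleton)
  then show ?thesis
    by (auto simp: tensor_tuple_def product_def tensor_def generated_ultrafilter_def
        empty_in_star_set_singleton)
qed

text \<open>Transfer of the statement that \<open>B\<close> is the preimage of \<open>A\<close> under the projection to \<open>F\<close>.\<close>

lemma star_proj:
  assumes sets: "\<forall>S \<in> set Ss. is_set S" and "is_set A" and "B \<subseteq> product Ss"
    and B: "\<And>ss. ss \<in> listset Ss \<Longrightarrow> tuple ss \<in> B \<longleftrightarrow> tuple (nths ss F) \<in> A"
    and len: "length \<alpha>s = length Ss" and F: "F \<inter> {..<length Ss} \<noteq> {}"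
    and \<alpha>: "tuple \<alpha>s \<in> star_set (product Ss)"
  shows "tuple \<alpha>s \<in> star_set B \<longleftrightarrow> tuple (nths \<alpha>s F) \<in> star_set A"
proof -
  \<comment> \<open>\<open>proj_fm\<close> with parameter \<open>n\<close> concerns tuples of length
    \<open>n + 1\<close>.\<close>
  define n where "n = length Ss - 1"
  have n: "length Ss = Suc n" using F by (cases Ss) (auto simp: n_def)
  have P: "is_set (product Ss)" using sets by (rule is_set_product)
  then have "is_set B" using assms(3) is_set_subset by blast
  \<comment> \<open>Variables 0, 1, 2 hold the product, \<open>A\<close> and \<open>B\<close>; in
    the formulas below, 3 is a point of the product and 4 its projection.\<close>
  define e where "e = ((\<lambda>_::nat. as_elem {})(0 := as_elem (product Ss), 1 := as_elem A, 2 := as_elem B))"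
  define \<psi> where "\<psi> = BEx 4 1 (proj_fm F 4 3 n [] 5)"
  define \<phi> where "\<phi> = BAll 3 0 (Disj (Conj (Mem 3 2) \<psi>) (Conj (Neg (Mem 3 2)) (Neg \<psi>)))"
  have F': "F \<inter> {..n} \<noteq> {}" using F n by (simp add: lessThan_Suc_atMost)
  have sat: "sat E d \<phi> \<longleftrightarrow> (\<forall>p. E p (d 0) \<longrightarrow> (E p (d 2) \<longleftrightarrow>
      (\<exists>q. E q (d 1) \<and> (\<exists>ss. length ss = Suc n \<and> p = tuple ss \<and> q = tuple (nths ss F)))))" for d
  proof -
    have "sat E d (proj_fm F 4 3 n [] 5) \<longleftrightarrow>
        (\<exists>ss. length ss = Suc n \<and> d 3 = tuple ss \<and> d 4 = tuple (nths ss F))" for d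
      using F' by (subst sat_proj_fm) auto
    then have \<psi>: "sat E d \<psi> \<longleftrightarrow>
        (\<exists>q. E q (d 1) \<and> (\<exists>ss. length ss = Suc n \<and> d 3 = tuple ss \<and> q = tuple (nths ss F)))" for d
      by (simp add: \<psi>_def conj_ac)
    have "sat E d \<phi> \<longleftrightarrow> (\<forall>p. E p (d 0) \<longrightarrow> (E p (d 2) \<longleftrightarrow> sat E (d(3 := p)) \<psi>))"
      by (simp add: \<phi>_def) blast
    then show ?thesis by (simp add: \<psi>)
  qed
  \<comment> \<open>By injectivity of tuples of fixed length, \<open>ts\<close> is the only possible
    witness for \<open>ss\<close>.\<close>
  have decode: "(\<exists>q. Q q \<and> (\<exists>ss. length ss = Suc n \<and> tuple ts = tuple ss \<and> q = tuple (nths ss F)))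
      \<longleftrightarrow> Q (tuple (nths ts F))" if "length ts = Suc n" for ts Q
  proof -
    have "length ss = Suc n \<and> tuple ts = tuple ss \<longleftrightarrow> ss = ts" for ss
      using that tuple_inject[of ss ts] by auto
    then show ?thesis by (simp flip: conj_assoc)
  qed
  have "p \<in> B \<longleftrightarrow> (\<exists>q. q \<in> A \<and> (\<exists>ss. length ss = Suc n \<and> p = tuple ss \<and> q = tuple (nths ss F)))"
    if p: "p \<in> product Ss" for p
  proof -
    obtain ss where ss: "ss \<in> listset Ss" "p = tuple ss" using p by (auto simp: product_def)
    then show ?thesis
      using decode[of ss "\<lambda>q. q \<in> A"] listset_length[OF ss(1)] B[OF ss(1)] n by simp
  qed
  then have "sat E e \<phi>"
    using P \<open>is_set A\<close> \<open>is_set B\<close> by (simp add: sat e_def as_elem)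
  \<comment> \<open>Transfer replaces only the three parameters. The length \<open>Suc n\<close> is
    a fixed natural number, so the formula still speaks of ordinary tuples and their
    projections.\<close>
  then have "sat E (star \<circ> e) \<phi>" using transfer by blast
  then have "tuple \<alpha>s \<in> star_set B \<longleftrightarrow> (\<exists>q. q \<in> star_set A \<and>
      (\<exists>ss. length ss = Suc n \<and> tuple \<alpha>s = tuple ss \<and> q = tuple (nths ss F)))"
    using \<alpha> by (simp add: sat e_def star_set_def)
  also have "\<dots> \<longleftrightarrow> tuple (nths \<alpha>s F) \<in> star_set A"
    using decode len n by simp
  finally show ?thesis .
qed

text \<open>Apply \<open>star_proj\<close> with \<open>F = {i}\<close>: the preimage of the
  \<open>i\<close>-th factor is the whole product, and a one-entry tuple is its entry.\<close>

lemma component_in_star_set: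
  assumes "\<forall>S \<in> set Ss. is_set S" "length \<alpha>s = length Ss" "i < length Ss"
    and "tuple \<alpha>s \<in> star_set (product Ss)"
  shows "\<alpha>s ! i \<in> star_set (Ss ! i)"
proof -
  have "tuple (nths ss {i}) \<in> Ss ! i" if "ss \<in> listset Ss" for ss
  proof -
    have "[ss ! i] \<in> listset [Ss ! i]"
      using nths_in_listset[OF that, of "{i}"] listset_length[OF that] assms(3)
      by (simp add: nths_singleton del: listset.simps)
    then show ?thesis
      using listset_length[OF that] assms(3) by (simp add: nths_singleton set_Cons_def)
  qed
  then have "tuple (nths \<alpha>s {i}) \<in> star_set (Ss ! i)"
    using assms star_proj[of Ss "Ss ! i" "product Ss" "{i}" \<alpha>s] by (auto simp: product_def)
  then show ?thesis using assms by (simp add: nths_singleton)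
qed

text \<open>Tested on a set \<open>A\<close>, both ultrafilters over \<open>F\<close> reduce to the
  given equality tested on the preimage of \<open>A\<close>.\<close>

lemma tensor_tuple_nths:
  assumes sets: "\<forall>S \<in> set Ss. is_set S" and tens: "tensor_tuple Ss \<alpha>s"
  shows "tensor_tuple (nths Ss F) (nths \<alpha>s F)"
proof (cases "F \<inter> {..<length Ss} = {}")
  case True
  then have "nths Ss F = []" "nths \<alpha>s F = []"
    using tens by (auto simp: set_nths tensor_tuple_def simp flip: set_empty)
  then show ?thesis by (simp add: tensor_tuple_Nil)
next
  case F: False
  have len: "length \<alpha>s = length Ss" and \<alpha>: "tuple \<alpha>s \<in> star_set (product Ss)"
    and eq: "generated_ultrafilter (product Ss) (tuple \<alpha>s) =
       tensor Ss (map2 generated_ultrafilter Ss \<alpha>s)"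
    using tens by (auto simp: tensor_tuple_def)
  define Us where "Us = map2 generated_ultrafilter Ss \<alpha>s"
  have Us_nths: "nths Us F = map2 generated_ultrafilter (nths Ss F) (nths \<alpha>s F)"
    by (simp add: Us_def nths_map nths_zip len)
  have sets_nths: "\<forall>S \<in> set (nths Ss F). is_set S"
    using sets set_nths_subset[of Ss F] by blast
  note product_set = is_set_product[OF sets_nths]
  have proj: "tuple (nths ss F) \<in> product (nths Ss F)" if "ss \<in> listset Ss" for ss
    using nths_in_listset[OF that] by (simp add: product_def)
  \<comment> \<open>The factor belongs to its ultrafilter because the component lies in its star
    extension; the empty set does not because its star extension is empty.\<close>
  have filters: "list_all2 (\<lambda>S U. S \<in> U \<and> {} \<notin> U) Ss Us"
    using component_in_star_set[OF sets len _ \<alpha>] len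
    by (auto simp: list_all2_conv_all_nth Us_def generated_ultrafilter_def star_set_empty)
  \<comment> \<open>Here the preimage of the smaller product is all of
    \<open>product Ss\<close>.\<close>
  have "tuple (nths \<alpha>s F) \<in> star_set (product (nths Ss F))"
    using star_proj[OF sets product_set subset_refl _ len F \<alpha>] \<alpha> proj by (auto simp: product_def)
  moreover have "tuple (nths \<alpha>s F) \<in> star_set A \<longleftrightarrow> iterated (nths Ss F) (nths Us F) (\<lambda>ss. tuple ss \<in> A)"
    if A: "A \<subseteq> product (nths Ss F)" for A
  proof -
    define B where "B = {tuple ss |ss. ss \<in> listset Ss \<and> tuple (nths ss F) \<in> A}"
    have B_sub: "B \<subseteq> product Ss" by (auto simp: B_def product_def)
    have B: "tuple ss \<in> B \<longleftrightarrow> tuple (nths ss F) \<in> A" if "ss \<in> listset Ss" for ss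
    proof -
      have "ts = ss" if "ts \<in> listset Ss" "tuple ss = tuple ts" for ts
        using tuple_inject[of ss ts] that \<open>ss \<in> listset Ss\<close> by (simp add: listset_length)
      then show ?thesis using that by (auto simp: B_def)
    qed
    have "tuple (nths \<alpha>s F) \<in> star_set A \<longleftrightarrow> tuple \<alpha>s \<in> star_set B"
      using star_proj[OF sets is_set_subset[OF product_set A] B_sub B len F \<alpha>] by simp
    also have "\<dots> \<longleftrightarrow> B \<in> generated_ultrafilter (product Ss) (tuple \<alpha>s)"
      using B_sub by (simp add: generated_ultrafilter_def)
    also have "\<dots> \<longleftrightarrow> iterated Ss Us (\<lambda>ss. tuple ss \<in> B)"
      using B_sub by (simp add: eq tensor_def Us_def)
    also have "\<dots> \<longleftrightarrow> iterated Ss Us (\<lambda>ss. tuple (nths ss F) \<in> A)"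
      using B len by (intro iterated_cong) (auto simp: Us_def)
    also have "\<dots> \<longleftrightarrow> iterated (nths Ss F) (nths Us F) (\<lambda>ss. tuple ss \<in> A)"
      using iterated_nths[OF filters, where P = "\<lambda>ss. tuple ss \<in> A"] .
    finally show ?thesis .
  qed
  ultimately show ?thesis
    using len unfolding tensor_tuple_def Us_nths[symmetric]
    by (auto simp: generated_ultrafilter_def tensor_def length_nths)
qed

end

theorem theorem4p28:
  fixes X :: "'v set" and E :: "'v \<Rightarrow> 'v \<Rightarrow> bool" and star :: "'v \<Rightarrow> 'v"
    and k :: nat and Ss :: "'v set list" and \<alpha>s :: "'v list"
  assumes "single_superstructure_model X E star"
    and "k \<ge> 1"
    and "length Ss = k + 1"
    and "\<forall>S \<in> set Ss. superstructure.is_set X E S"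
    and "length \<alpha>s = k + 1"
    and "superstructure.tuple X E \<alpha>s \<in>
           single_superstructure_model.star_set X E star (superstructure.product X E Ss)"
  shows "single_superstructure_model.tensor_tuple X E star Ss \<alpha>s \<longleftrightarrow>
         (\<forall>F \<subseteq> {0..k}. single_superstructure_model.tensor_tuple X E star (nths Ss F) (nths \<alpha>s F))"
proof -
  interpret single_superstructure_model X E star by (rule assms(1))
  \<comment> \<open>Indices start at 0, so \<open>{0..k}\<close> selects all \<open>k + 1\<close>
    entries and the full tuple is itself an instance of the right-hand side.\<close>
  have "nths Ss {0..k} = Ss" "nths \<alpha>s {0..k} = \<alpha>s"
    using assms(3,5) by (auto intro!: nths_all)
  then have "tensor_tuple Ss \<alpha>s" if "\<forall>F \<subseteq> {0..k}. tensor_tuple (nths Ss F) (nths \<alpha>s F)"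
    using that[rule_format, of "{0..k}"] by simp
  then show ?thesis using tensor_tuple_nths[OF assms(4)] by blast
qed

end
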